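(* Let $n\ge1$, and for $1\le k\le n$ let $$G_k=\begin{bmatrix}I_{k-1}&0&0&0\\0&\alpha_k&\beta_k&0\\0&\gamma_k&\delta_k&0\\0&0&0&I_{n-k}\end{bmatrix}\in\mathbb C^{(n+1)\times(n+1)},\qquad \alpha_k,\beta_k,\gamma_k,\delta_k\in\mathbb C.$$ Let $A,B,C,D\in\mathbb C^{(n+1)\times(n+1)}$ be diagonal matrices, and for a permutation $\pi=(\pi_1,\dots,\pi_n)$ of $(1,\dots,n)$ let $M_\pi=\prod_{k\in\pi}G_k=G_{\pi_1}G_{\pi_2}\cdots G_{\pi_n}$. Let $R=(AM_\pi+C)(BM_\pi+D)^{-1}$. Then the eigenvalues of $R$ do not depend on the permutation $\pi$. If $BM_\pi+D$ is not invertible, then, more generally, the pencil $(AM_\pi+C,\;BM_\pi+D)$ has eigenvalues that do not depend on $\pi$.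
   Context: $I_m$ denotes the $m\times m$ identity matrix ($I_0$ is the empty matrix). The eigenvalues of a pencil $(X,Y)$ of square matrices are the solutions $\lambda$ of $\det(X-\lambda Y)=0$. *)

theory Defs
  imports
    "Jordan_Normal_Form.Gauss_Jordan_Elimination"
    "Jordan_Normal_Form.Spectral_Radius"
    "HOL-Combinatorics.Multiset_Permutations"
begin

definition G_mat ::
  "nat \<Rightarrow> (nat \<Rightarrow> complex) \<Rightarrow> (nat \<Rightarrow> complex) \<Rightarrow> (nat \<Rightarrow> complex) \<Rightarrow> (nat \<Rightarrow> complex) \<Rightarrow> nat \<Rightarrow> complex mat"
  where
  "G_mat n \<alpha> \<beta> \<gamma> \<delta> k =
     diag_block_mat
       [1\<^sub>m (k - 1),
        mat_of_rows_list 2 [[\<alpha> k, \<beta> k], [\<gamma> k, \<delta> k]],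
        1\<^sub>m (n - k)]"

lemma G_mat_carrier:
  assumes "1 \<le> k" "k \<le> n"
  shows "G_mat n \<alpha> \<beta> \<gamma> \<delta> k \<in> carrier_mat (n + 1) (n + 1)"
  using assms
  by (intro carrier_matI) (simp_all add: G_mat_def dim_diag_block_mat mat_of_rows_list_def)

text \<open>A permutation is given as the list of its values; the factors are multiplied in list order.\<close>

definition M_mat ::
  "nat \<Rightarrow> (nat \<Rightarrow> complex) \<Rightarrow> (nat \<Rightarrow> complex) \<Rightarrow> (nat \<Rightarrow> complex) \<Rightarrow> (nat \<Rightarrow> complex) \<Rightarrow> nat list \<Rightarrow> complex mat"
  where
  "M_mat n \<alpha> \<beta> \<gamma> \<delta> \<pi> = foldr (\<lambda>k P. G_mat n \<alpha> \<beta> \<gamma> \<delta> k * P) \<pi> (1\<^sub>m (n + 1))"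

text \<open>Meaningful only if \<open>B * M + D\<close> is invertible: otherwise \<^const>\<open>mat_inverse\<close> is
  \<^const>\<open>None\<close>.\<close>

definition R_mat ::
  "complex mat \<Rightarrow> complex mat \<Rightarrow> complex mat \<Rightarrow> complex mat \<Rightarrow> complex mat \<Rightarrow> complex mat"
  where
  "R_mat A B C D M = (A * M + C) * the (mat_inverse (B * M + D))"

definition pencil_eigenvalues :: "complex mat \<Rightarrow> complex mat \<Rightarrow> complex set" where
  "pencil_eigenvalues X Y = {z. det (X - z \<cdot>\<^sub>m Y) = 0}"

text \<open>The polynomial \<open>det (X - z Y)\<close> in the indeterminate \<open>z\<close>. It is zero for a singular pencil,
  for which every complex number is an eigenvalue.\<close>

definition pencil_poly :: "complex mat \<Rightarrow> complex mat \<Rightarrow> complex poly" where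
  "pencil_poly X Y = det (mat (dim_row X) (dim_col X) (\<lambda>(i, j). [:X $$ (i, j), - (Y $$ (i, j)):]))"

lemma poly_pencil_poly:
  assumes "X \<in> carrier_mat m m" "Y \<in> carrier_mat m m"
  shows "poly (pencil_poly X Y) z = det (X - z \<cdot>\<^sub>m Y)"
proof -
  have hom: "comm_ring_hom (\<lambda>p :: complex poly. poly p z)"
    by unfold_locales auto
  let ?P = "mat (dim_row X) (dim_col X) (\<lambda>(i, j). [:X $$ (i, j), - (Y $$ (i, j)):])"
  have "map_mat (\<lambda>p. poly p z) ?P = X - z \<cdot>\<^sub>m Y"
    using assms by (intro eq_matI) auto
  then show ?thesis
    unfolding pencil_poly_def using comm_ring_hom.hom_det[OF hom, of ?P] by simp
qed

lemma pencil_eigenvalues_eq_roots: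
  assumes "X \<in> carrier_mat m m" "Y \<in> carrier_mat m m"
  shows "pencil_eigenvalues X Y = {z. poly (pencil_poly X Y) z = 0}"
  using poly_pencil_poly[OF assms] by (simp add: pencil_eigenvalues_def)

end

theory Submission
  imports Defs
begin

text \<open>
  Every assertion reduces to one: for diagonal matrices \<open>E\<close> and \<open>F\<close> the number
  \<open>det (E M\<^sub>\<pi> + F)\<close> does not depend on \<open>\<pi>\<close>. Indeed
  \<open>x (A M\<^sub>\<pi> + C) + y (B M\<^sub>\<pi> + D)\<close> has this form with \<open>E = x A + y B\<close> and \<open>F = x C + y D\<close>, so its
  determinant, hence the whole pencil with its multiplicities, is the same for all \<open>\<pi>\<close>. The pair
  \<open>(x, y) = (0, 1)\<close> gives the determinant of \<open>Y = B M\<^sub>\<pi> + D\<close>, and \<open>(- 1, z)\<close> gives the characteristic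
  polynomial of \<open>R = X Y\<^sup>-\<^sup>1\<close>, because \<open>det (z - R) det Y = det (z Y - X)\<close>.

  The invariance is shown by induction on the number \<open>k\<close> of factors. All factors except
  \<open>G\<^bsub>k-1\<^esub>\<close> commute with the last one, \<open>G\<^sub>k\<close>. So \<open>G\<^sub>k\<close> can be moved to the right end of the product
  or to the left end, according to the side on which \<open>G\<^bsub>k-1\<^esub>\<close> stands, and \<open>M\<^sub>\<pi>\<close> equals \<open>N G\<^sub>k\<close> or
  \<open>G\<^sub>k N\<close>, where \<open>N\<close> is a product of \<open>G\<^sub>1, \<dots>, G\<^bsub>k-1\<^esub>\<close> in some order. Two facts finish the step.

  First, \<open>det (E N G\<^sub>k + F)\<close> is a combination of numbers \<open>det (E' N + F')\<close> with \<open>E'\<close> and \<open>F'\<close> diagonal,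
  and \<open>\<beta>\<^sub>k\<close>, \<open>\<gamma>\<^sub>k\<close> occur in the coefficients only through their product
  (lemma \<open>diag_pencil_det_mult_block\<close>). The induction hypothesis applies to these numbers.

  Secondly, \<open>det (E N + F) = det (E N\<^sup>T + F)\<close> (lemma \<open>diag_pencil_det_transpose\<close>). As \<open>G\<^sub>k\<^sup>T\<close> is \<open>G\<^sub>k\<close>
  with \<open>\<beta>\<^sub>k\<close> and \<open>\<gamma>\<^sub>k\<close> exchanged, both facts together give
  \<open>det (E G\<^sub>k N + F) = det (E N\<^sup>T G\<^sub>k\<^sup>T + F) = det (E N G\<^sub>k + F)\<close>, so the two sides are equally good.
\<close>

section \<open>Determinants with a diagonal scaling and a diagonal shift\<close>

text \<open>This is \<open>det (E N + F)\<close> for the diagonal matrices \<open>E\<close>, \<open>F\<close> with entries \<open>e\<close>, \<open>f\<close>. Functions in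
  place of matrices turn a change of a single diagonal entry into a function update.\<close>

definition diag_pencil_det ::
  "nat \<Rightarrow> (nat \<Rightarrow> 'a :: comm_ring_1) \<Rightarrow> (nat \<Rightarrow> 'a) \<Rightarrow> 'a mat \<Rightarrow> 'a" where
  "diag_pencil_det m e f N =
     det (mat m m (\<lambda>(i, j). e i * N $$ (i, j) + (if i = j then f i else 0)))"

text \<open>Transposition turns \<open>E N\<^sup>T + F\<close> into \<open>N E + F\<close>, so the point is that \<open>E\<close> may be moved across
  \<open>N\<close>. In the Leibniz formula, the term of a permutation \<open>p\<close> has the factor \<open>e\<^sub>i\<close> or \<open>e\<^bsub>p(i)\<^esub>\<close>
  according to the side of \<open>E\<close>. These agree at the fixed points of \<open>p\<close>, the only places where \<open>f\<close>
  enters, and \<open>p\<close> permutes the remaining indices, so the products over them agree as well.\<close>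

lemma diag_pencil_det_transpose:
  assumes N: "N \<in> carrier_mat m m"
  shows "diag_pencil_det m e f (transpose_mat N) = diag_pencil_det m e f N"
proof -
  let ?X = "mat m m (\<lambda>(i, j). e i * N $$ (i, j) + (if i = j then f i else 0))"
  let ?Y = "mat m m (\<lambda>(i, j). e j * N $$ (i, j) + (if i = j then f i else 0))"
  have *: "(\<Prod>i = 0..<m. ?X $$ (i, p i)) = (\<Prod>i = 0..<m. ?Y $$ (i, p i))"
    if p: "p permutes {0..<m}" for p
  proof -
    define F where "F = {i \<in> {0..<m}. p i = i}"
    define S where "S = {i \<in> {0..<m}. p i \<noteq> i}"
    have pin: "p i < m" if "i < m" for i using permutes_in_image[OF p, of i] that by simp
    have split: "prod g {0..<m} = prod g F * prod g S" for g :: "nat \<Rightarrow> 'a"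
      by (subst prod.union_disjoint[symmetric]) (auto simp: F_def S_def intro!: prod.cong)
    have inj: "inj p" using p by (rule permutes_inj)
    have bij: "bij_betw p S S"
      unfolding bij_betw_def
    proof
      show "inj_on p S" using inj inj_on_subset by blast
      show "p ` S = S"
      proof (rule card_subset_eq)
        show "finite S" by (simp add: S_def)
        show "p ` S \<subseteq> S" using pin inj by (auto simp: S_def dest: injD)
        show "card (p ` S) = card S" using inj by (meson card_image inj_on_subset subset_UNIV)
      qed
    qed
    have "(\<Prod>i\<in>S. ?X $$ (i, p i)) = (\<Prod>i\<in>S. e i) * (\<Prod>i\<in>S. N $$ (i, p i))"
      unfolding prod.distrib[symmetric] by (rule prod.cong) (auto simp: S_def pin)
    also have "(\<Prod>i\<in>S. e i) = (\<Prod>i\<in>S. e (p i))"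
      using prod.reindex_bij_betw[OF bij, of e] by simp
    also have "\<dots> * (\<Prod>i\<in>S. N $$ (i, p i)) = (\<Prod>i\<in>S. ?Y $$ (i, p i))"
      unfolding prod.distrib[symmetric] by (rule prod.cong) (auto simp: S_def pin)
    finally have "(\<Prod>i\<in>S. ?X $$ (i, p i)) = (\<Prod>i\<in>S. ?Y $$ (i, p i))" .
    moreover have "(\<Prod>i\<in>F. ?X $$ (i, p i)) = (\<Prod>i\<in>F. ?Y $$ (i, p i))"
      by (rule prod.cong) (auto simp: F_def)
    ultimately show ?thesis unfolding split by simp
  qed
  have "det ?X = det ?Y"
    unfolding det_def'[OF mat_carrier] by (rule sum.cong[OF refl]) (use * in auto)
  also have "\<dots> = det (transpose_mat ?Y)"
    by (rule det_transpose[symmetric, OF mat_carrier])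
  also have "transpose_mat ?Y
      = mat m m (\<lambda>(i, j). e i * transpose_mat N $$ (i, j) + (if i = j then f i else 0))"
    by (rule eq_matI) (use N in auto)
  finally show ?thesis unfolding diag_pencil_det_def by simp
qed

definition det_with_cols ::
  "nat \<Rightarrow> (nat \<Rightarrow> nat \<Rightarrow> 'a :: comm_ring_1) \<Rightarrow> nat \<Rightarrow> nat \<Rightarrow> (nat \<Rightarrow> 'a) \<Rightarrow> (nat \<Rightarrow> 'a) \<Rightarrow> 'a" where
  "det_with_cols m W p q x y =
     det (mat m m (\<lambda>(i, j). if j = p then x i else if j = q then y i else W i j))"

text \<open>The cofactors along a column do not see the entries of that column.\<close>

lemma det_col_linear:
  fixes W :: "nat \<Rightarrow> nat \<Rightarrow> 'a :: comm_ring_1"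
  assumes c: "c < m"
  shows "det (mat m m (\<lambda>(i, j). if j = c then a * u i + b * v i else W i j))
       = a * det (mat m m (\<lambda>(i, j). if j = c then u i else W i j))
       + b * det (mat m m (\<lambda>(i, j). if j = c then v i else W i j))"
proof -
  let ?M = "\<lambda>x. mat m m (\<lambda>(i, j). if j = c then x i else W i j)"
  have cof: "cofactor (?M x) i c = cofactor (?M u) i c" if "i < m" for x i
  proof -
    have "mat_delete (?M x) i c = mat_delete (?M u) i c"
      unfolding mat_delete_def by (rule eq_matI) (use c that in auto)
    thus ?thesis by (simp add: cofactor_def)
  qed
  have lap: "det (?M x) = (\<Sum>i<m. x i * cofactor (?M u) i c)" for x
    unfolding laplace_expansion_column[OF mat_carrier c]
    by (rule sum.cong[OF refl]) (use c cof[of _ x] in auto)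
  show ?thesis
    unfolding lap[of "\<lambda>i. a * u i + b * v i"] lap[of u] lap[of v]
    by (simp add: algebra_simps sum.distrib sum_distrib_left)
qed

lemma det_with_cols_linear_left:
  assumes "p < m"
  shows "det_with_cols m W p q (\<lambda>i. a * u i + b * v i) y
       = a * det_with_cols m W p q u y + b * det_with_cols m W p q v y"
  unfolding det_with_cols_def by (rule det_col_linear[OF assms])

lemma det_with_cols_linear_right:
  assumes "q < m" "p \<noteq> q"
  shows "det_with_cols m W p q x (\<lambda>i. a * u i + b * v i)
       = a * det_with_cols m W p q x u + b * det_with_cols m W p q x v"
proof -
  have *: "det_with_cols m W p q x y
      = det (mat m m (\<lambda>(i, j). if j = q then y i else if j = p then x i else W i j))" for y
    unfolding det_with_cols_def using assms by (intro arg_cong[of _ _ det] eq_matI) auto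
  show ?thesis unfolding * by (rule det_col_linear[OF assms(1)])
qed

lemma det_with_cols_same:
  assumes "p < m" "q < m" "p \<noteq> q"
  shows "det_with_cols m W p q x x = 0"
  unfolding det_with_cols_def
  by (rule det_identical_columns[OF mat_carrier assms(3,1,2)]) (use assms in \<open>auto intro!: eq_vecI\<close>)

lemma det_zero_row:
  assumes A: "A \<in> carrier_mat m m" and "r < m" and "\<And>j. j < m \<Longrightarrow> A $$ (r, j) = 0"
  shows "det A = 0"
  unfolding laplace_expansion_row[OF A \<open>r < m\<close>] using assms(3) by simp

section \<open>Reduction of a factor acting on two adjacent coordinates\<close>

text \<open>That is, \<open>N\<close> is block diagonal with an identity block on the indices \<open>\<ge> q\<close>.\<close>

definition trivial_from :: "nat \<Rightarrow> 'a :: {zero,one} mat \<Rightarrow> bool" where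
  "trivial_from q N \<longleftrightarrow>
     (\<forall>i < dim_row N. \<forall>j < dim_col N. q \<le> i \<or> q \<le> j \<longrightarrow> N $$ (i, j) = (if i = j then 1 else 0))"

text \<open>
  Here \<open>NG\<close> is \<open>N\<close> times the identity matrix with the block of rows \<open>(a, b)\<close> and \<open>(c, d)\<close> at the
  indices \<open>p\<close> and \<open>q = p + 1\<close>. Only columns \<open>p\<close> and \<open>q\<close> of \<open>E N G + F\<close> differ from those of
  \<open>E N + F\<close>. With \<open>u\<close> the column \<open>p\<close> of \<open>E N\<close> and \<open>g = e\<^sub>q d + f\<^sub>q\<close>, they are
  \<open>a u + c e\<^sub>q \<epsilon>\<^sub>q + f\<^sub>p \<epsilon>\<^sub>p\<close> and \<open>b u + g \<epsilon>\<^sub>q\<close>, where \<open>\<epsilon>\<^sub>p\<close>, \<open>\<epsilon>\<^sub>q\<close> are unit vectors. Expanding by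
  linearity, \<open>b\<close> and \<open>c\<close> can occur separately only in the terms of the column pairs
  \<open>(\<epsilon>\<^sub>q, \<epsilon>\<^sub>q)\<close> and \<open>(\<epsilon>\<^sub>p, u)\<close>. Both vanish, the second because row \<open>q\<close> becomes zero.
  The surviving determinants, with columns \<open>(u, \<epsilon>\<^sub>q)\<close> and \<open>(\<epsilon>\<^sub>p, \<epsilon>\<^sub>q)\<close>, are expressed through
  the original \<open>N\<close> with changed diagonal entries: \<open>e\<^sub>q = 0\<close> and \<open>f\<^sub>q = 1\<close> make column \<open>q\<close> equal to
  \<open>\<epsilon>\<^sub>q\<close>, and \<open>f\<^sub>p = t\<close> makes column \<open>p\<close> equal to \<open>u + t \<epsilon>\<^sub>p\<close>.
\<close>

lemma diag_pencil_det_mult_block: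
  fixes N G :: "'a :: comm_ring_1 mat"
  assumes N: "N \<in> carrier_mat m m" and "Suc p < m"
    and triv: "trivial_from (Suc p) N"
    and col_p: "\<And>i. i < m \<Longrightarrow> NG $$ (i, p) = a * N $$ (i, p) + c * N $$ (i, Suc p)"
    and col_q: "\<And>i. i < m \<Longrightarrow> NG $$ (i, Suc p) = b * N $$ (i, p) + d * N $$ (i, Suc p)"
    and col: "\<And>i j. i < m \<Longrightarrow> j < m \<Longrightarrow> j \<noteq> p \<Longrightarrow> j \<noteq> Suc p \<Longrightarrow> NG $$ (i, j) = N $$ (i, j)"
  defines "\<Phi> \<equiv> \<lambda>t. \<lambda>e f. diag_pencil_det m (e(Suc p := 0)) (f(p := t, Suc p := 1)) N"
  shows "diag_pencil_det m e f NG =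
    (a * (e (Suc p) * d + f (Suc p)) - b * c * e (Suc p)) * \<Phi> 0 e f
    + f p * (e (Suc p) * d + f (Suc p)) * (\<Phi> 1 e f - \<Phi> 0 e f)"
proof -
  define q where "q = Suc p"
  have pq: "p < m" "q < m" "p \<noteq> q" using assms(2) by (auto simp: q_def)
  define W where "W = (\<lambda>i j. e i * N $$ (i, j) + (if i = j then f i else 0))"
  define u where "u = (\<lambda>i. e i * N $$ (i, p))"
  define ep where "ep = (\<lambda>i. if i = p then 1 else 0 :: 'a)"
  define eq where "eq = (\<lambda>i. if i = q then 1 else 0 :: 'a)"
  define g where "g = e q * d + f q"
  let ?D = "det_with_cols m W p q"
  have Nq: "N $$ (i, j) = (if i = j then 1 else 0)" if "i < m" "j < m" "i = q \<or> j = q" for i j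
    using triv that N by (auto simp: trivial_from_def q_def)
  have "diag_pencil_det m e f NG
      = ?D (\<lambda>i. a * u i + 1 * (c * e q * eq i + f p * ep i)) (\<lambda>i. b * u i + g * eq i)"
    unfolding diag_pencil_det_def det_with_cols_def
  proof (intro arg_cong[of _ _ det] eq_matI, goal_cases)
    case (1 i j)
    hence ij: "i < m" "j < m" by auto
    consider "j = p" | "j = q" | "j \<noteq> p" "j \<noteq> q" by blast
    thus ?case
      using ij pq col_p[of i] col_q[of i] col[of i j] Nq[of i q]
      by cases (auto simp: q_def[symmetric] u_def ep_def eq_def g_def W_def algebra_simps)
  qed auto
  also have "\<dots> = a * ?D u (\<lambda>i. b * u i + g * eq i)
      + (c * e q * ?D eq (\<lambda>i. b * u i + g * eq i) + f p * ?D ep (\<lambda>i. b * u i + g * eq i))"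
    unfolding det_with_cols_linear_left[OF pq(1)] by simp
  also have "\<dots> = (a * g) * ?D u eq + c * e q * b * ?D eq u + f p * b * ?D ep u + f p * g * ?D ep eq"
    unfolding det_with_cols_linear_right[OF pq(2,3)]
    by (simp add: det_with_cols_same[OF pq] algebra_simps)
  \<comment> \<open>A determinant with two equal columns vanishes, so it is alternating.\<close>
  also have "?D eq u = - ?D u eq"
  proof -
    have "0 = ?D (\<lambda>i. 1 * u i + 1 * eq i) (\<lambda>i. 1 * u i + 1 * eq i)"
      by (rule det_with_cols_same[OF pq, symmetric])
    also have "\<dots> = ?D u eq + ?D eq u"
      unfolding det_with_cols_linear_left[OF pq(1)] det_with_cols_linear_right[OF pq(2,3)]
      by (simp add: det_with_cols_same[OF pq])
    finally show ?thesis by (simp add: eq_neg_iff_add_eq_0 add.commute)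
  qed
  also have "?D ep u = 0"
    unfolding det_with_cols_def
    by (rule det_zero_row[OF mat_carrier pq(2)]) (use pq Nq in \<open>auto simp: ep_def u_def W_def\<close>)
  \<comment> \<open>Written as a difference, since setting \<open>e p = 0\<close> to remove \<open>u\<close> would also change row \<open>p\<close>.\<close>
  also have "?D ep eq = ?D (\<lambda>i. 1 * u i + 1 * ep i) eq - ?D u eq"
    unfolding det_with_cols_linear_left[OF pq(1)] by simp
  also have "?D (\<lambda>i. 1 * u i + 1 * ep i) eq = \<Phi> 1 e f"
    unfolding \<Phi>_def diag_pencil_det_def det_with_cols_def q_def[symmetric]
    using pq Nq by (intro arg_cong[of _ _ det] eq_matI) (auto simp: u_def ep_def eq_def W_def)
  also have "?D u eq = \<Phi> 0 e f"
    unfolding \<Phi>_def diag_pencil_det_def det_with_cols_def q_def[symmetric]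
    using pq Nq by (intro arg_cong[of _ _ det] eq_matI) (auto simp: u_def ep_def eq_def W_def)
  finally show ?thesis
    unfolding g_def q_def by (simp add: algebra_simps)
qed

section \<open>The factors and their products\<close>

text \<open>Matrix indices start at 0, so the block of the factor number \<open>k\<close> sits at the indices
  \<open>k - 1\<close> and \<open>k\<close>.\<close>

lemma G_mat_index:
  assumes "1 \<le> k" "k \<le> n" "i \<le> n" "j \<le> n"
  shows "G_mat n \<alpha> \<beta> \<gamma> \<delta> k $$ (i, j) =
    (if j = k - 1 then (if i = k - 1 then \<alpha> k else if i = k then \<gamma> k else 0)
     else if j = k then (if i = k - 1 then \<beta> k else if i = k then \<delta> k else 0)
     else if i = j then 1 else 0)"
proof -
  obtain l where l: "k = Suc l" using assms(1) by (cases k) auto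
  define P where "P = mat_of_rows_list 2 [[\<alpha> k, \<beta> k], [\<gamma> k, \<delta> k]]"
  define T where "T = four_block_mat P (0\<^sub>m 2 (n - k)) (0\<^sub>m (n - k) 2) (1\<^sub>m (n - k))"
  have dimP: "dim_row P = 2" "dim_col P = 2" by (auto simp: P_def mat_of_rows_list_def)
  have P: "P $$ (0, 0) = \<alpha> k" "P $$ (0, Suc 0) = \<beta> k"
    "P $$ (Suc 0, 0) = \<gamma> k" "P $$ (Suc 0, Suc 0) = \<delta> k"
    by (auto simp: P_def mat_of_rows_list_def)
  have dimT: "dim_row T = 2 + (n - k)" "dim_col T = 2 + (n - k)"
    by (auto simp: T_def dimP)
  have T: "T $$ (r, c) = (if r < 2 then if c < 2 then P $$ (r, c) else 0
      else if c < 2 then 0 else if r = c then 1 else 0)"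
    if "r < 2 + (n - k)" "c < 2 + (n - k)" for r c
    using that unfolding T_def by (subst index_mat_four_block) (auto simp: dimP)
  have "four_block_mat (1\<^sub>m (n - k)) (0\<^sub>m (n - k) 0) (0\<^sub>m 0 (n - k)) (0\<^sub>m 0 0)
      = (1\<^sub>m (n - k) :: complex mat)"
    by (rule eq_matI) auto
  hence "G_mat n \<alpha> \<beta> \<gamma> \<delta> k =
      four_block_mat (1\<^sub>m l) (0\<^sub>m l (2 + (n - k))) (0\<^sub>m (2 + (n - k)) l) T"
    unfolding G_mat_def P_def[symmetric] by (simp add: Let_def dimP T_def l del: One_nat_def)
  hence "G_mat n \<alpha> \<beta> \<gamma> \<delta> k $$ (i, j) =
      (if i < l then if j < l then (if i = j then 1 else 0) else 0
       else if j < l then 0 else T $$ (i - l, j - l))"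
    using assms l by (simp add: dimT)
  moreover have "i < l \<or> i = l \<or> i = Suc l \<or> i > Suc l" by linarith
  moreover have "j < l \<or> j = l \<or> j = Suc l \<or> j > Suc l" by linarith
  ultimately show ?thesis
    using assms(2-4) T[of "i - l" "j - l"] unfolding l
    by (elim disjE) (auto simp: P[unfolded l])
qed

lemma transpose_G_mat:
  assumes "1 \<le> k" "k \<le> n"
  shows "transpose_mat (G_mat n \<alpha> \<beta> \<gamma> \<delta> k) = G_mat n \<alpha> \<gamma> \<beta> \<delta> k"
  using G_mat_carrier[OF assms, of \<alpha> \<beta> \<gamma> \<delta>] G_mat_carrier[OF assms, of \<alpha> \<gamma> \<beta> \<delta>] assms
  by (intro eq_matI) (auto simp: G_mat_index)

lemma mult_G_mat_index:
  assumes k: "1 \<le> k" "k \<le> n" and N: "N \<in> carrier_mat (n + 1) (n + 1)" and ij: "i \<le> n" "j \<le> n"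
  shows "(N * G_mat n \<alpha> \<beta> \<gamma> \<delta> k) $$ (i, j) =
    (if j = k - 1 then \<alpha> k * N $$ (i, k - 1) + \<gamma> k * N $$ (i, k)
     else if j = k then \<beta> k * N $$ (i, k - 1) + \<delta> k * N $$ (i, k)
     else N $$ (i, j))"
proof -
  let ?G = "G_mat n \<alpha> \<beta> \<gamma> \<delta> k"
  define T where "T = (if j = k - 1 \<or> j = k then {k - 1, k} else {j})"
  have "(N * ?G) $$ (i, j) = (\<Sum>l \<in> {0..<n + 1}. N $$ (i, l) * ?G $$ (l, j))"
    using N G_mat_carrier[OF k, of \<alpha> \<beta> \<gamma> \<delta>] ij by (auto simp: scalar_prod_def intro!: sum.cong)
  also have "\<dots> = (\<Sum>l \<in> T. N $$ (i, l) * ?G $$ (l, j))"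
    by (rule sum.mono_neutral_right) (use k ij in \<open>auto simp: T_def G_mat_index split: if_splits\<close>)
  finally show ?thesis
    using k ij by (auto simp: T_def G_mat_index algebra_simps)
qed

lemma G_mat_mult_index:
  assumes k: "1 \<le> k" "k \<le> n" and N: "N \<in> carrier_mat (n + 1) (n + 1)" and ij: "i \<le> n" "j \<le> n"
  shows "(G_mat n \<alpha> \<beta> \<gamma> \<delta> k * N) $$ (i, j) =
    (if i = k - 1 then \<alpha> k * N $$ (k - 1, j) + \<beta> k * N $$ (k, j)
     else if i = k then \<gamma> k * N $$ (k - 1, j) + \<delta> k * N $$ (k, j)
     else N $$ (i, j))"
proof -
  let ?G = "G_mat n \<alpha> \<beta> \<gamma> \<delta> k"
  note G = G_mat_carrier[OF k, of \<alpha> \<beta> \<gamma> \<delta>]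
  have NT: "transpose_mat N \<in> carrier_mat (n + 1) (n + 1)" using N by simp
  have "(?G * N) $$ (i, j) = transpose_mat (?G * N) $$ (j, i)"
    using N G ij by auto
  also have "\<dots> = (transpose_mat N * G_mat n \<alpha> \<gamma> \<beta> \<delta> k) $$ (j, i)"
    unfolding transpose_mult[OF G N] transpose_G_mat[OF k] ..
  finally show ?thesis
    unfolding mult_G_mat_index[OF k NT ij(2,1)] using N k ij by auto
qed

lemma M_mat_carrier:
  assumes "set xs \<subseteq> {1..n}"
  shows "M_mat n \<alpha> \<beta> \<gamma> \<delta> xs \<in> carrier_mat (n + 1) (n + 1)"
  using assms
proof (induction xs)
  case (Cons x xs)
  hence "G_mat n \<alpha> \<beta> \<gamma> \<delta> x \<in> carrier_mat (n + 1) (n + 1)"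
    using G_mat_carrier[of x n \<alpha> \<beta> \<gamma> \<delta>] by auto
  from mult_carrier_mat[OF this] Cons show ?case by (simp add: M_mat_def)
qed (simp add: M_mat_def)

lemma M_mat_append:
  assumes "set xs \<subseteq> {1..n}" "set ys \<subseteq> {1..n}"
  shows "M_mat n \<alpha> \<beta> \<gamma> \<delta> (xs @ ys) = M_mat n \<alpha> \<beta> \<gamma> \<delta> xs * M_mat n \<alpha> \<beta> \<gamma> \<delta> ys"
  using assms(1)
proof (induction xs)
  case Nil
  thus ?case using M_mat_carrier[OF assms(2), of \<alpha> \<beta> \<gamma> \<delta>] by (simp add: M_mat_def)
next
  case (Cons x xs)
  hence "G_mat n \<alpha> \<beta> \<gamma> \<delta> x \<in> carrier_mat (n + 1) (n + 1)" "set xs \<subseteq> {1..n}"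
    using G_mat_carrier[of x n \<alpha> \<beta> \<gamma> \<delta>] by auto
  thus ?case
    using Cons.IH M_mat_carrier[OF assms(2), of \<alpha> \<beta> \<gamma> \<delta>] M_mat_carrier[of xs n \<alpha> \<beta> \<gamma> \<delta>]
    by (simp add: M_mat_def)
qed

lemma trivial_from_M_mat:
  assumes "set xs \<subseteq> {1..n}" "\<And>x. x \<in> set xs \<Longrightarrow> x < q"
  shows "trivial_from q (M_mat n \<alpha> \<beta> \<gamma> \<delta> xs)"
  using assms
proof (induction xs)
  case (Cons x xs)
  hence x: "1 \<le> x" "x \<le> n" "x < q" and xs: "set xs \<subseteq> {1..n}" by auto
  note c = M_mat_carrier[OF xs, of \<alpha> \<beta> \<gamma> \<delta>] G_mat_carrier[OF x(1,2), of \<alpha> \<beta> \<gamma> \<delta>]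
  have IH: "trivial_from q (M_mat n \<alpha> \<beta> \<gamma> \<delta> xs)" using Cons by auto
  have "M_mat n \<alpha> \<beta> \<gamma> \<delta> (x # xs) = G_mat n \<alpha> \<beta> \<gamma> \<delta> x * M_mat n \<alpha> \<beta> \<gamma> \<delta> xs"
    by (simp add: M_mat_def)
  moreover have "(G_mat n \<alpha> \<beta> \<gamma> \<delta> x * M_mat n \<alpha> \<beta> \<gamma> \<delta> xs) $$ (i, j) = (if i = j then 1 else 0)"
    if "i \<le> n" "j \<le> n" "q \<le> i \<or> q \<le> j" for i j
    unfolding G_mat_mult_index[OF x(1,2) c(1) that(1,2)]
    using IH x that carrier_matD[OF c(1)] by (auto simp: trivial_from_def)
  ultimately show ?case
    using c by (auto simp: trivial_from_def less_Suc_eq_le simp del: index_mult_mat(1))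
qed (auto simp: M_mat_def trivial_from_def)

text \<open>The two matrices act on disjoint sets of coordinates.\<close>

lemma G_mat_mult_commute:
  assumes k: "1 \<le> k" "k \<le> n" and N: "N \<in> carrier_mat (n + 1) (n + 1)"
    and triv: "trivial_from (k - 1) N"
  shows "G_mat n \<alpha> \<beta> \<gamma> \<delta> k * N = N * G_mat n \<alpha> \<beta> \<gamma> \<delta> k"
proof (rule eq_matI, goal_cases)
  case (1 i j)
  have *: "N $$ (i, j) = (if i = j then 1 else 0)" if "i \<le> n" "j \<le> n" "k - 1 \<le> i \<or> k - 1 \<le> j" for i j
    using triv that N by (auto simp: trivial_from_def)
  from 1 have "i \<le> n" "j \<le> n" using N G_mat_carrier[OF k, of \<alpha> \<beta> \<gamma> \<delta>] by auto
  thus ?case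
    unfolding mult_G_mat_index[OF k N \<open>i \<le> n\<close> \<open>j \<le> n\<close>] G_mat_mult_index[OF k N \<open>i \<le> n\<close> \<open>j \<le> n\<close>]
    using k by (auto simp: *)
qed (use N G_mat_carrier[OF k, of \<alpha> \<beta> \<gamma> \<delta>] in auto)

section \<open>Independence of the order of the factors\<close>

lemma diag_pencil_det_mult_G_mat:
  assumes k: "1 \<le> k" "k \<le> n" and N: "N \<in> carrier_mat (n + 1) (n + 1)"
    and triv: "trivial_from k N"
  defines "\<Phi> \<equiv> \<lambda>t e f. diag_pencil_det (n + 1) (e(k := 0)) (f(k - 1 := t, k := 1)) N"
  shows "diag_pencil_det (n + 1) e f (N * G_mat n \<alpha> \<beta> \<gamma> \<delta> k) =
    (\<alpha> k * (e k * \<delta> k + f k) - \<beta> k * \<gamma> k * e k) * \<Phi> 0 e f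
    + f (k - 1) * (e k * \<delta> k + f k) * (\<Phi> 1 e f - \<Phi> 0 e f)"
proof -
  have S: "Suc (k - 1) = k" using k by simp
  show ?thesis
    unfolding \<Phi>_def
    by (rule diag_pencil_det_mult_block[where p = "k - 1", unfolded S, OF N])
      (use k triv in \<open>auto simp: mult_G_mat_index[OF k N] less_Suc_eq_le simp del: index_mult_mat(1)\<close>)
qed

text \<open>The matrices \<open>G N\<close> and \<open>N G\<close> differ in general. By transposition the left side becomes the
  reduction formula for \<open>N\<^sup>T\<close> with \<open>\<beta>\<close> and \<open>\<gamma>\<close> exchanged, and that formula is invariant under both
  changes.\<close>

lemma diag_pencil_det_G_mat_commute:
  assumes k: "1 \<le> k" "k \<le> n" and N: "N \<in> carrier_mat (n + 1) (n + 1)"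
    and triv: "trivial_from k N"
  shows "diag_pencil_det (n + 1) e f (G_mat n \<alpha> \<beta> \<gamma> \<delta> k * N)
       = diag_pencil_det (n + 1) e f (N * G_mat n \<alpha> \<beta> \<gamma> \<delta> k)"
proof -
  note G = G_mat_carrier[OF k, of \<alpha> \<beta> \<gamma> \<delta>]
  have NT: "transpose_mat N \<in> carrier_mat (n + 1) (n + 1)" using N by simp
  have trivT: "trivial_from k (transpose_mat N)"
    using triv N unfolding trivial_from_def by auto
  have "diag_pencil_det (n + 1) e f (G_mat n \<alpha> \<beta> \<gamma> \<delta> k * N)
      = diag_pencil_det (n + 1) e f (transpose_mat (G_mat n \<alpha> \<beta> \<gamma> \<delta> k * N))"
    by (rule diag_pencil_det_transpose[symmetric]) (use G N in auto)
  also have "transpose_mat (G_mat n \<alpha> \<beta> \<gamma> \<delta> k * N) = transpose_mat N * G_mat n \<alpha> \<gamma> \<beta> \<delta> k"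
    unfolding transpose_mult[OF G N] transpose_G_mat[OF k] ..
  finally show ?thesis
    unfolding diag_pencil_det_mult_G_mat[OF k NT trivT] diag_pencil_det_mult_G_mat[OF k N triv]
      diag_pencil_det_transpose[OF N]
    by (simp add: mult.commute)
qed

text \<open>The index \<open>k - 1\<close> is absent from \<open>xs\<close> or from \<open>ys\<close>, so the factor number \<open>k\<close> commutes with
  the whole product on that side and can be brought to an end of the product; if that is the left
  end, the determinant still allows a change to the right end.\<close>

lemma diag_pencil_det_M_mat_extract_max:
  assumes k: "1 \<le> k" "k \<le> n"
    and sub: "set xs \<union> set ys \<subseteq> {1..<k}" and disj: "set xs \<inter> set ys = {}"
  shows "diag_pencil_det (n + 1) e f (M_mat n \<alpha> \<beta> \<gamma> \<delta> (xs @ k # ys))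
       = diag_pencil_det (n + 1) e f (M_mat n \<alpha> \<beta> \<gamma> \<delta> (xs @ ys) * G_mat n \<alpha> \<beta> \<gamma> \<delta> k)"
proof -
  let ?M = "M_mat n \<alpha> \<beta> \<gamma> \<delta>" and ?G = "G_mat n \<alpha> \<beta> \<gamma> \<delta> k"
  have xs: "set xs \<subseteq> {1..n}" and ys: "set ys \<subseteq> {1..n}" and kys: "set (k # ys) \<subseteq> {1..n}"
    using sub k by auto
  note X = M_mat_carrier[OF xs, of \<alpha> \<beta> \<gamma> \<delta>] and Y = M_mat_carrier[OF ys, of \<alpha> \<beta> \<gamma> \<delta>]
    and G = G_mat_carrier[OF k, of \<alpha> \<beta> \<gamma> \<delta>]
  have "?M (k # ys) = ?G * ?M ys" by (simp add: M_mat_def)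
  hence M: "?M (xs @ k # ys) = ?M xs * (?G * ?M ys)" "?M (xs @ ys) = ?M xs * ?M ys"
    using M_mat_append[OF xs kys, of \<alpha> \<beta> \<gamma> \<delta>] M_mat_append[OF xs ys, of \<alpha> \<beta> \<gamma> \<delta>] by simp_all
  have "k - 1 \<notin> set ys \<or> k - 1 \<notin> set xs" using disj by auto
  thus ?thesis
  proof
    assume "k - 1 \<notin> set ys"
    hence "x < k - 1" if "x \<in> set ys" for x
      using that sub by (cases "x = k - 1") force+
    hence "?G * ?M ys = ?M ys * ?G"
      by (intro G_mat_mult_commute k Y trivial_from_M_mat ys)
    thus ?thesis unfolding M assoc_mult_mat[OF X Y G] by simp
  next
    assume "k - 1 \<notin> set xs"
    hence "x < k - 1" if "x \<in> set xs" for x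
      using that sub by (cases "x = k - 1") force+
    hence "?G * ?M xs = ?M xs * ?G"
      by (intro G_mat_mult_commute k X trivial_from_M_mat xs)
    hence "?M (xs @ k # ys) = ?G * ?M (xs @ ys)"
      unfolding M using assoc_mult_mat[OF X G Y] assoc_mult_mat[OF G X Y] by simp
    moreover have "trivial_from k (?M (xs @ ys))"
      by (rule trivial_from_M_mat) (use sub xs ys in auto)
    moreover have "?M (xs @ ys) \<in> carrier_mat (n + 1) (n + 1)"
      by (rule M_mat_carrier) (use xs ys in auto)
    ultimately show ?thesis using diag_pencil_det_G_mat_commute[OF k] by simp
  qed
qed

text \<open>After the last factor is moved to the right end, the reduction formula involves the remaining
  product \<open>N\<close> only through determinants \<open>det (E' N + F')\<close>. The diagonals \<open>E'\<close>, \<open>F'\<close> are not the given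
  ones, so the induction hypothesis has to cover all of them.\<close>

lemma diag_pencil_det_M_mat_perm:
  assumes "k \<le> n" "\<pi> \<in> permutations_of_set {1..k}" "\<sigma> \<in> permutations_of_set {1..k}"
  shows "diag_pencil_det (n + 1) e f (M_mat n \<alpha> \<beta> \<gamma> \<delta> \<pi>)
       = diag_pencil_det (n + 1) e f (M_mat n \<alpha> \<beta> \<gamma> \<delta> \<sigma>)"
  using assms
proof (induction k arbitrary: \<pi> \<sigma> e f)
  case 0
  thus ?case by simp
next
  case (Suc k)
  let ?\<Phi> = "\<lambda>e f xs. diag_pencil_det (n + 1) e f (M_mat n \<alpha> \<beta> \<gamma> \<delta> xs)"
  have k: "1 \<le> Suc k" "Suc k \<le> n" using Suc.prems by auto
  have peel: "\<exists>\<rho> \<in> permutations_of_set {1..k}. \<forall>e f. ?\<Phi> e f \<tau> =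
      diag_pencil_det (n + 1) e f (M_mat n \<alpha> \<beta> \<gamma> \<delta> \<rho> * G_mat n \<alpha> \<beta> \<gamma> \<delta> (Suc k))"
    if \<tau>: "\<tau> \<in> permutations_of_set {1..Suc k}" for \<tau>
  proof -
    note t = permutations_of_setD[OF \<tau>]
    from t(1) have "Suc k \<in> set \<tau>" by simp
    then obtain xs ys where xy: "\<tau> = xs @ Suc k # ys" by (auto simp: in_set_conv_decomp)
    have "set xs \<union> set ys = set \<tau> - {Suc k}" using t(2) unfolding xy by auto
    also have "\<dots> = {1..k}" unfolding t(1) by auto
    finally have s: "set xs \<union> set ys = {1..k}" .
    hence "xs @ ys \<in> permutations_of_set {1..k}"
      using t(2) unfolding xy by (intro permutations_of_setI) auto
    moreover have "set xs \<union> set ys \<subseteq> {1..<Suc k}" "set xs \<inter> set ys = {}"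
      using s t(2) unfolding xy by auto
    ultimately show ?thesis
      unfolding xy using diag_pencil_det_M_mat_extract_max[OF k] by blast
  qed
  obtain \<pi>' \<sigma>' where
    p: "\<pi>' \<in> permutations_of_set {1..k}" "\<And>e f. ?\<Phi> e f \<pi> =
      diag_pencil_det (n + 1) e f (M_mat n \<alpha> \<beta> \<gamma> \<delta> \<pi>' * G_mat n \<alpha> \<beta> \<gamma> \<delta> (Suc k))" and
    s: "\<sigma>' \<in> permutations_of_set {1..k}" "\<And>e f. ?\<Phi> e f \<sigma> =
      diag_pencil_det (n + 1) e f (M_mat n \<alpha> \<beta> \<gamma> \<delta> \<sigma>' * G_mat n \<alpha> \<beta> \<gamma> \<delta> (Suc k))"
    using peel[OF Suc.prems(2)] peel[OF Suc.prems(3)] by blast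
  have IH: "?\<Phi> e f \<pi>' = ?\<Phi> e f \<sigma>'" for e f
    using Suc.IH[OF _ p(1) s(1)] k by simp
  have M: "M_mat n \<alpha> \<beta> \<gamma> \<delta> \<tau> \<in> carrier_mat (n + 1) (n + 1)"
    "trivial_from (Suc k) (M_mat n \<alpha> \<beta> \<gamma> \<delta> \<tau>)" if "\<tau> \<in> permutations_of_set {1..k}" for \<tau>
  proof -
    have "set \<tau> \<subseteq> {1..n}" "\<And>x. x \<in> set \<tau> \<Longrightarrow> x < Suc k"
      using permutations_of_setD(1)[OF that] k by auto
    note \<tau> = this
    show "M_mat n \<alpha> \<beta> \<gamma> \<delta> \<tau> \<in> carrier_mat (n + 1) (n + 1)"
      by (rule M_mat_carrier[OF \<tau>(1)])
    show "trivial_from (Suc k) (M_mat n \<alpha> \<beta> \<gamma> \<delta> \<tau>)"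
      by (rule trivial_from_M_mat[OF \<tau>])
  qed
  show ?case
    unfolding p(2) s(2) diag_pencil_det_mult_G_mat[OF k M[OF p(1)]]
      diag_pencil_det_mult_G_mat[OF k M[OF s(1)]] IH ..
qed

section \<open>Pencils, inverses and characteristic polynomials\<close>

lemma diagonal_mult_index:
  fixes A :: "'a :: comm_ring_1 mat"
  assumes A: "A \<in> carrier_mat m m" "diagonal_mat A" and N: "N \<in> carrier_mat m m"
    and "i < m" "j < m"
  shows "(A * N) $$ (i, j) = A $$ (i, i) * N $$ (i, j)"
proof -
  have "(A * N) $$ (i, j) = (\<Sum>l \<in> {0..<m}. A $$ (i, l) * N $$ (l, j))"
    using assms by (auto simp: scalar_prod_def intro!: sum.cong)
  also have "\<dots> = (\<Sum>l \<in> {i}. A $$ (i, l) * N $$ (l, j))"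
    by (rule sum.mono_neutral_right) (use assms in \<open>auto simp: diagonal_mat_def\<close>)
  finally show ?thesis by simp
qed

text \<open>Both matrices of the pencil are affine in the same \<open>N\<close>, so any linear combination of them is
  again a diagonal multiple of \<open>N\<close> plus a diagonal matrix. Two coefficients instead of the usual
  \<open>X - z Y\<close> let one identity also cover \<open>Y\<close> alone and \<open>z Y - X\<close>.\<close>

lemma det_diagonal_pencil:
  fixes A B C D N :: "'a :: comm_ring_1 mat"
  assumes A: "A \<in> carrier_mat m m" "diagonal_mat A" and B: "B \<in> carrier_mat m m" "diagonal_mat B"
    and C: "C \<in> carrier_mat m m" "diagonal_mat C" and D: "D \<in> carrier_mat m m" "diagonal_mat D"
    and N: "N \<in> carrier_mat m m"
  shows "det (x \<cdot>\<^sub>m (A * N + C) + y \<cdot>\<^sub>m (B * N + D))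
    = diag_pencil_det m (\<lambda>i. x * A $$ (i, i) + y * B $$ (i, i)) (\<lambda>i. x * C $$ (i, i) + y * D $$ (i, i)) N"
  unfolding diag_pencil_det_def
proof (intro arg_cong[of _ _ det] eq_matI, goal_cases)
  case (1 i j)
  hence ij: "i < m" "j < m" by auto
  have "C $$ (i, j) = (if i = j then C $$ (i, i) else 0)" "D $$ (i, j) = (if i = j then D $$ (i, i) else 0)"
    using C D ij by (auto simp: diagonal_mat_def)
  moreover have "dim_row N = m" "dim_col N = m" using N by auto
  ultimately show ?case
    using ij assms diagonal_mult_index[OF A N ij] diagonal_mult_index[OF B N ij]
    by (auto simp: algebra_simps simp del: index_mult_mat(1))
qed (use assms in auto)

lemma invertible_mat_iff_det:
  fixes Y :: "'a :: field mat"
  assumes Y: "Y \<in> carrier_mat m m"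
  shows "invertible_mat Y \<longleftrightarrow> det Y \<noteq> 0"
proof
  assume "invertible_mat Y"
  then obtain Z where Z: "inverts_mat Y Z" "inverts_mat Z Y" unfolding invertible_mat_def by blast
  hence "Y * Z = 1\<^sub>m m" using Y by (auto simp: inverts_mat_def)
  moreover have "Z \<in> carrier_mat m m"
    using Z Y unfolding inverts_mat_def
    by (metis carrier_matD(1,2) carrier_matI index_mult_mat(2,3) index_one_mat(2,3))
  ultimately have "det Y * det Z = 1" using det_mult[OF Y] by (metis det_one)
  thus "det Y \<noteq> 0" by auto
next
  assume "det Y \<noteq> 0"
  from det_non_zero_imp_unit[OF Y this]
  obtain Z where "Z \<in> carrier_mat m m" "Z * Y = 1\<^sub>m m" "Y * Z = 1\<^sub>m m"
    unfolding Units_def ring_mat_def by auto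
  thus "invertible_mat Y"
    using Y by (auto simp: invertible_mat_def inverts_mat_def)
qed

text \<open>With \<open>R = X Y\<^sup>-\<^sup>1\<close> one has \<open>(z - R) Y = z Y - X\<close>.\<close>

lemma poly_char_poly_mult_the_inverse:
  fixes X Y :: "'a :: field mat"
  assumes X: "X \<in> carrier_mat m m" and Y: "Y \<in> carrier_mat m m" and "invertible_mat Y"
  shows "X * the (mat_inverse Y) \<in> carrier_mat m m"
    and "poly (char_poly (X * the (mat_inverse Y))) z * det Y = det (- 1 \<cdot>\<^sub>m X + z \<cdot>\<^sub>m Y)"
proof -
  have "det Y \<noteq> 0" using assms invertible_mat_iff_det by blast
  hence "mat_inverse Y \<noteq> None"
    using mat_inverse(1)[OF Y, of "()"] det_non_zero_imp_unit[OF Y, of "()"] by blast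
  then obtain Z where "mat_inverse Y = Some Z" by blast
  hence Z: "the (mat_inverse Y) = Z" "Z * Y = 1\<^sub>m m" "Z \<in> carrier_mat m m"
    using mat_inverse(2)[OF Y] by auto
  show R: "X * the (mat_inverse Y) \<in> carrier_mat m m" using X Z by auto
  define R where "R = X * Z"
  have Rc: "R \<in> carrier_mat m m" using X Z by (auto simp: R_def)
  have RY: "R * Y = X" using X Y Z by (simp add: R_def)
  have "poly (char_poly R) z = det (- (char_matrix R z))"
    by (rule char_poly_matrix[OF Rc])
  also have "- (char_matrix R z) = z \<cdot>\<^sub>m 1\<^sub>m m - R"
    using Rc by (intro eq_matI) (auto simp: char_matrix_def)
  also have "det (z \<cdot>\<^sub>m 1\<^sub>m m - R) * det Y = det ((z \<cdot>\<^sub>m 1\<^sub>m m - R) * Y)"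
    by (rule det_mult[symmetric]) (use Rc Y in auto)
  also have "(z \<cdot>\<^sub>m 1\<^sub>m m - R) * Y = z \<cdot>\<^sub>m 1\<^sub>m m * Y - R * Y"
    by (rule minus_mult_distrib_mat) (use Rc Y in auto)
  also have "\<dots> = - 1 \<cdot>\<^sub>m X + z \<cdot>\<^sub>m Y"
    unfolding RY using X Y mult_smult_assoc_mat[of "1\<^sub>m m" m m Y m z] by (intro eq_matI) auto
  finally show "poly (char_poly (X * the (mat_inverse Y))) z * det Y = det (- 1 \<cdot>\<^sub>m X + z \<cdot>\<^sub>m Y)"
    unfolding Z(1) R_def .
qed

theorem theorem11p5:
  fixes n :: nat
    and \<alpha> \<beta> \<gamma> \<delta> :: "nat \<Rightarrow> complex"
    and A B C D :: "complex mat"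
    and \<pi> \<sigma> :: "nat list"
  assumes "n \<ge> 1"
    and "A \<in> carrier_mat (n + 1) (n + 1)" "diagonal_mat A"
    and "B \<in> carrier_mat (n + 1) (n + 1)" "diagonal_mat B"
    and "C \<in> carrier_mat (n + 1) (n + 1)" "diagonal_mat C"
    and "D \<in> carrier_mat (n + 1) (n + 1)" "diagonal_mat D"
    and "\<pi> \<in> permutations_of_set {1..n}"
    and "\<sigma> \<in> permutations_of_set {1..n}"
  shows
    "let M = M_mat n \<alpha> \<beta> \<gamma> \<delta>;
         R = (\<lambda>\<tau>. R_mat A B C D (M \<tau>));
         X = (\<lambda>\<tau>. A * M \<tau> + C);
         Y = (\<lambda>\<tau>. B * M \<tau> + D)
     in (invertible_mat (Y \<pi>) \<longrightarrow>
           invertible_mat (Y \<sigma>) \<and>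
           spectrum (R \<pi>) = spectrum (R \<sigma>) \<and>
           proots (char_poly (R \<pi>)) = proots (char_poly (R \<sigma>))) \<and>
        pencil_eigenvalues (X \<pi>) (Y \<pi>) = pencil_eigenvalues (X \<sigma>) (Y \<sigma>) \<and>
        proots (pencil_poly (X \<pi>) (Y \<pi>)) = proots (pencil_poly (X \<sigma>) (Y \<sigma>))"
proof -
  define M where "M = M_mat n \<alpha> \<beta> \<gamma> \<delta>"
  define X where "X = (\<lambda>\<tau>. A * M \<tau> + C)"
  define Y where "Y = (\<lambda>\<tau>. B * M \<tau> + D)"
  define R where "R = (\<lambda>\<tau>. R_mat A B C D (M \<tau>))"
  let ?m = "n + 1"
  have M: "M \<pi> \<in> carrier_mat ?m ?m" "M \<sigma> \<in> carrier_mat ?m ?m"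
    unfolding M_def using permutations_of_setD(1)[OF assms(10)] permutations_of_setD(1)[OF assms(11)]
    by (intro M_mat_carrier; simp)+
  have X: "X \<pi> \<in> carrier_mat ?m ?m" "X \<sigma> \<in> carrier_mat ?m ?m"
    and Y: "Y \<pi> \<in> carrier_mat ?m ?m" "Y \<sigma> \<in> carrier_mat ?m ?m"
    using M assms by (auto simp: X_def Y_def)
  have key: "det (x \<cdot>\<^sub>m X \<pi> + y \<cdot>\<^sub>m Y \<pi>) = det (x \<cdot>\<^sub>m X \<sigma> + y \<cdot>\<^sub>m Y \<sigma>)" for x y
    unfolding X_def Y_def det_diagonal_pencil[OF assms(2-9) M(1)] det_diagonal_pencil[OF assms(2-9) M(2)]
    unfolding M_def by (rule diag_pencil_det_M_mat_perm[OF order_refl assms(10,11)])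
  have pencil: "U - z \<cdot>\<^sub>m V = 1 \<cdot>\<^sub>m U + (- z) \<cdot>\<^sub>m V"
    if "U \<in> carrier_mat ?m ?m" "V \<in> carrier_mat ?m ?m" for U V :: "complex mat" and z
    using that by (intro eq_matI) auto
  have pp: "pencil_poly (X \<pi>) (Y \<pi>) = pencil_poly (X \<sigma>) (Y \<sigma>)"
    unfolding poly_eq_poly_eq_iff[symmetric] fun_eq_iff
      poly_pencil_poly[OF X(1) Y(1)] poly_pencil_poly[OF X(2) Y(2)]
      pencil[OF X(1) Y(1)] pencil[OF X(2) Y(2)] key by simp
  have pe: "pencil_eigenvalues (X \<pi>) (Y \<pi>) = pencil_eigenvalues (X \<sigma>) (Y \<sigma>)"
    unfolding pencil_eigenvalues_eq_roots[OF X(1) Y(1)] pencil_eigenvalues_eq_roots[OF X(2) Y(2)] pp ..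
  have R: "R \<tau> = X \<tau> * the (mat_inverse (Y \<tau>))" for \<tau>
    by (simp add: R_def R_mat_def X_def Y_def)
  have "invertible_mat (Y \<sigma>) \<and> spectrum (R \<pi>) = spectrum (R \<sigma>) \<and> char_poly (R \<pi>) = char_poly (R \<sigma>)"
    if inv: "invertible_mat (Y \<pi>)"
  proof -
    have "0 \<cdot>\<^sub>m U + 1 \<cdot>\<^sub>m V = V"
      if "U \<in> carrier_mat ?m ?m" "V \<in> carrier_mat ?m ?m" for U V :: "complex mat"
      using that by (intro eq_matI) auto
    with key[of 0 1] have dY: "det (Y \<pi>) = det (Y \<sigma>)" using X Y by metis
    have inv': "invertible_mat (Y \<sigma>)" and nz: "det (Y \<sigma>) \<noteq> 0"
      using inv dY invertible_mat_iff_det[OF Y(1)] invertible_mat_iff_det[OF Y(2)] by auto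
    note c1 = poly_char_poly_mult_the_inverse[OF X(1) Y(1) inv, folded R]
    note c2 = poly_char_poly_mult_the_inverse[OF X(2) Y(2) inv', folded R]
    have "poly (char_poly (R \<pi>)) z * det (Y \<sigma>) = poly (char_poly (R \<sigma>)) z * det (Y \<sigma>)" for z
      using c1(2)[of z] unfolding c2(2) dY key .
    hence cp: "char_poly (R \<pi>) = char_poly (R \<sigma>)"
      using nz by (simp add: poly_eq_poly_eq_iff[symmetric] fun_eq_iff)
    show ?thesis
      using inv' cp spectrum_root_char_poly[OF c1(1)] spectrum_root_char_poly[OF c2(1)] by simp
  qed
  thus ?thesis
    using pp pe unfolding Let_def M_def X_def Y_def R_def by simp
qed

end
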